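(* Let $(X,\mu)$ be a subdirectly irreducible state BCK-algebra, and let $\operatorname{Ker}(\mu)=\mu^{-1}(\{0\})$. (i) If $\operatorname{Ker}(\mu)=\{0\}$, then $\mu(X)$ is a subdirectly irreducible subalgebra of $X$. (ii) If $\operatorname{Ker}(\mu)\neq\{0\}$, then $\operatorname{Ker}(\mu)$ is a subdirectly irreducible subalgebra of $X$ and $\operatorname{Ker}(\mu)\cap\langle a\rangle_X\neq\{0\}$ for each non-zero element $a$ of $\mu(X)$.
   Context: A BCK-algebra is an algebra $(X,*,0)$ of type $(2,0)$ such that for all $x,y,z\in X$: $((x*y)*(x*z))*(z*y)=0$; $x*0=x$; $x*y=0$ and $y*x=0$ imply $x=y$; $0*x=0$. A state BCK-algebra is a pair $(X,\mu)$ where $X$ is a BCK-algebra and $\mu:X\to X$ is a (left) state operator, i.e. for all $x,y\in X$: (S0) $x*y=0$ implies $\mu(x)*\mu(y)=0$; (S1) $\mu(x*y)=\mu(x)*\mu(x*(x*y))$; (S2) $\mu(\mu(x)*\mu(y))=\mu(x)*\mu(y)$. It is regarded as an algebra $(X,*,\mu,0)$ of type $(2,1,0)$. An ideal of $X$ is a subset $I$ with $0\in I$ such that $y*x\in I$ and $x\in I$ imply $y\in I$. For $a\in X$, $\langle a\rangle_X$ is the least ideal of $X$ containing $a$. An algebra $A$ of type $F$ is subdirectly irreducible if for every subdirect embedding $\alpha:A\to\prod_{i\in I}A_i$ (an injective homomorphism into a product of algebras of type $F$ such that $\pi_i(\alpha(A))=A_i$ for all $i$, with $\pi_i$ the projections)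 there is $i\in I$ such that $\pi_i\circ\alpha:A\to A_i$ is an isomorphism. For $(X,\mu)$ this is understood in type $(2,1,0)$, and for the subalgebras $\mu(X)$ and $\operatorname{Ker}(\mu)$ of $X$ it is understood as for BCK-algebras, in type $(2,0)$. *)

theory Defs
  imports "HOL-Library.FuncSet"
begin

(* A type of algebras is the list of the arities, e.g. [2, 1, 0].  The operations of an
   algebra are listed in the same order and take the list of their arguments; their values
   on lists of the wrong length or outside the carrier are irrelevant. *)

record 'a alg =
  carrier :: "'a set"
  ops :: "('a list \<Rightarrow> 'a) list"

definition is_algebra :: "nat list \<Rightarrow> 'a alg \<Rightarrow> bool" where
  "is_algebra \<tau> A \<longleftrightarrow>
     carrier A \<noteq> {} \<and> length (ops A) = length \<tau> \<and>
     (\<forall>k<length \<tau>. \<forall>xs. length xs = \<tau> ! k \<longrightarrow> set xs \<subseteq> carrier A \<longrightarrow>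
        (ops A ! k) xs \<in> carrier A)"

definition subalgebra :: "nat list \<Rightarrow> 'a alg \<Rightarrow> 'a alg \<Rightarrow> bool" where
  "subalgebra \<tau> B A \<longleftrightarrow>
     is_algebra \<tau> A \<and> is_algebra \<tau> B \<and> carrier B \<subseteq> carrier A \<and>
     (\<forall>k<length \<tau>. \<forall>xs. length xs = \<tau> ! k \<longrightarrow> set xs \<subseteq> carrier B \<longrightarrow>
        (ops B ! k) xs = (ops A ! k) xs)"

definition homomorphism :: "nat list \<Rightarrow> 'a alg \<Rightarrow> 'b alg \<Rightarrow> ('a \<Rightarrow> 'b) \<Rightarrow> bool" where
  "homomorphism \<tau> A B h \<longleftrightarrow>
     h ` carrier A \<subseteq> carrier B \<and>
     (\<forall>k<length \<tau>. \<forall>xs. length xs = \<tau> ! k \<longrightarrow> set xs \<subseteq> carrier A \<longrightarrow>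
        h ((ops A ! k) xs) = (ops B ! k) (map h xs))"

definition isomorphism :: "nat list \<Rightarrow> 'a alg \<Rightarrow> 'b alg \<Rightarrow> ('a \<Rightarrow> 'b) \<Rightarrow> bool" where
  "isomorphism \<tau> A B h \<longleftrightarrow> homomorphism \<tau> A B h \<and> bij_betw h (carrier A) (carrier B)"

definition product_algebra :: "nat list \<Rightarrow> 'i set \<Rightarrow> ('i \<Rightarrow> 'b alg) \<Rightarrow> ('i \<Rightarrow> 'b) alg" where
  "product_algebra \<tau> I B =
     \<lparr> carrier = (\<Pi>\<^sub>E i\<in>I. carrier (B i)),
       ops = map (\<lambda>k ps. \<lambda>i\<in>I. (ops (B i) ! k) (map (\<lambda>p. p i) ps)) [0..<length \<tau>] \<rparr>"

definition subdirect_embedding ::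
  "nat list \<Rightarrow> 'a alg \<Rightarrow> 'i set \<Rightarrow> ('i \<Rightarrow> 'b alg) \<Rightarrow> ('a \<Rightarrow> 'i \<Rightarrow> 'b) \<Rightarrow> bool" where
  "subdirect_embedding \<tau> A I B \<alpha> \<longleftrightarrow>
     (\<forall>i\<in>I. is_algebra \<tau> (B i)) \<and>
     homomorphism \<tau> A (product_algebra \<tau> I B) \<alpha> \<and>
     inj_on \<alpha> (carrier A) \<and>
     (\<forall>i\<in>I. (\<lambda>p. p i) ` (\<alpha> ` carrier A) = carrier (B i))"

(* HOL cannot quantify over types inside a formula, so the type of the indices and the type
   carrying the factors are parameters.  By subdirectly_irreducible_all_types below, the
   instance with congruences as indices and sets of congruence classes as factors implies
   all other instances, and so expresses subdirect irreducibility without restriction.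
   As the empty index set is not excluded, a one-element algebra is not subdirectly
   irreducible. *)

definition subdirectly_irreducible ::
  "'i itself \<Rightarrow> 'b itself \<Rightarrow> nat list \<Rightarrow> 'a alg \<Rightarrow> bool" where
  "subdirectly_irreducible _ _ \<tau> A \<longleftrightarrow>
     (\<forall>(I :: 'i set) (B :: 'i \<Rightarrow> 'b alg) \<alpha>. subdirect_embedding \<tau> A I B \<alpha> \<longrightarrow>
        (\<exists>i\<in>I. isomorphism \<tau> A (B i) ((\<lambda>p. p i) \<circ> \<alpha>)))"

theorem subdirectly_irreducible_all_types:
  fixes A :: "'a alg"
  assumes A: "is_algebra \<tau> A"
    and si: "subdirectly_irreducible TYPE(('a \<times> 'a) set) TYPE('a set) \<tau> A"
  shows "subdirectly_irreducible TYPE('i) TYPE('b) \<tau> A"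
  unfolding subdirectly_irreducible_def
proof (intro allI impI)
  fix I :: "'i set" and B :: "'i \<Rightarrow> 'b alg" and \<alpha>
  assume emb: "subdirect_embedding \<tau> A I B \<alpha>"
  define \<theta> where "\<theta> i = {(x, y). x \<in> carrier A \<and> y \<in> carrier A \<and> \<alpha> x i = \<alpha> y i}" for i
  define J where "J = \<theta> ` I"
  define r where "r c = (SOME x. x \<in> c)" for c :: "'a set"
  define Q where "Q t = \<lparr> carrier = carrier A // t,
     ops = map (\<lambda>k cs. t `` {(ops A ! k) (map r cs)}) [0..<length \<tau>] \<rparr>" for t
  define \<beta> where "\<beta> x = (\<lambda>t\<in>J. t `` {x})" for x
  have closed: "(ops A ! k) xs \<in> carrier A"
    if "k < length \<tau>" "length xs = \<tau> ! k" "set xs \<subseteq> carrier A" for k xs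
    using A that by (auto simp: is_algebra_def)
  have coord: "\<alpha> ((ops A ! k) xs) i = (ops (B i) ! k) (map (\<lambda>x. \<alpha> x i) xs)"
    if "i \<in> I" "k < length \<tau>" "length xs = \<tau> ! k" "set xs \<subseteq> carrier A" for i k xs
    using emb that
    by (auto simp: subdirect_embedding_def homomorphism_def product_algebra_def o_def)
  have eqv: "equiv (carrier A) (\<theta> i)" for i
    by (auto simp: equiv_def refl_on_def sym_def trans_def \<theta>_def)
  have cls: "\<theta> i `` {x} = \<theta> i `` {y} \<longleftrightarrow> \<alpha> x i = \<alpha> y i"
    if "x \<in> carrier A" "y \<in> carrier A" for x y i
    using that by (auto simp: \<theta>_def)
  have rep: "r c \<in> c" "r c \<in> carrier A" if c: "c \<in> carrier A // \<theta> i" for c i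
  proof -
    obtain x where "x \<in> carrier A" "c = \<theta> i `` {x}"
      using c by (rule quotientE)
    then have x: "x \<in> c" "c \<subseteq> carrier A" by (auto simp: \<theta>_def)
    then show "r c \<in> c" unfolding r_def by (metis someI)
    with x show "r c \<in> carrier A" by auto
  qed
  have rep\<alpha>: "\<alpha> (r (\<theta> i `` {x})) i = \<alpha> x i" if "x \<in> carrier A" for x i
    using rep(1)[OF quotientI[OF that, of "\<theta> i"]] by (auto simp: \<theta>_def)
  have algQ: "is_algebra \<tau> (Q (\<theta> i))" for i
    unfolding is_algebra_def
  proof (intro conjI allI impI)
    show "carrier (Q (\<theta> i)) \<noteq> {}"
      using A by (auto simp: Q_def is_algebra_def quotient_def)
    show "length (ops (Q (\<theta> i))) = length \<tau>" by (simp add: Q_def)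
    fix k xs assume k: "k < length \<tau>" "length xs = \<tau> ! k" "set xs \<subseteq> carrier (Q (\<theta> i))"
    have "set (map r xs) \<subseteq> carrier A"
      using k(3) rep(2) by (auto simp: Q_def)
    with k show "(ops (Q (\<theta> i)) ! k) xs \<in> carrier (Q (\<theta> i))"
      by (auto simp: Q_def intro!: quotientI closed)
  qed
  have homQ: "\<theta> i `` {(ops A ! k) xs} = (ops (Q (\<theta> i)) ! k) (map (\<lambda>x. \<theta> i `` {x}) xs)"
    if i: "i \<in> I" and k: "k < length \<tau>" and xs: "length xs = \<tau> ! k" "set xs \<subseteq> carrier A" for i k xs
  proof -
    let ?ys = "map (\<lambda>x. r (\<theta> i `` {x})) xs"
    have ys: "set ?ys \<subseteq> carrier A"
      using xs(2) rep(2) by (auto intro: quotientI)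
    have "map (\<lambda>x. \<alpha> x i) ?ys = map (\<lambda>x. \<alpha> x i) xs"
      using xs(2) rep\<alpha> by auto
    then have "\<alpha> ((ops A ! k) xs) i = \<alpha> ((ops A ! k) ?ys) i"
      using coord[OF i k xs] coord[OF i k _ ys] xs(1) by (metis length_map)
    then have "\<theta> i `` {(ops A ! k) xs} = \<theta> i `` {(ops A ! k) ?ys}"
      using cls closed[OF k xs] closed[OF k _ ys] xs(1) by simp
    then show ?thesis using k by (simp add: Q_def o_def)
  qed
  have \<beta>: "\<beta> x (\<theta> i) = \<theta> i `` {x}" if "i \<in> I" for x i
    using that by (simp add: \<beta>_def J_def)
  have "subdirect_embedding \<tau> A J Q \<beta>"
    unfolding subdirect_embedding_def homomorphism_def
  proof (intro conjI ballI allI impI)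
    show "is_algebra \<tau> (Q t)" if "t \<in> J" for t
      using that algQ by (auto simp: J_def)
    show "\<beta> ` carrier A \<subseteq> carrier (product_algebra \<tau> J Q)"
      by (auto simp: \<beta>_def product_algebra_def Q_def intro: quotientI)
    show "\<beta> ((ops A ! k) xs) = (ops (product_algebra \<tau> J Q) ! k) (map \<beta> xs)"
      if "k < length \<tau>" "length xs = \<tau> ! k" "set xs \<subseteq> carrier A" for k xs
    proof
      fix t
      show "\<beta> ((ops A ! k) xs) t = (ops (product_algebra \<tau> J Q) ! k) (map \<beta> xs) t"
      proof (cases "t \<in> J")
        case True
        then obtain i where "i \<in> I" "t = \<theta> i" by (auto simp: J_def)
        with True homQ[OF _ that] \<beta> that(1) show ?thesis
          by (simp add: product_algebra_def o_def)
      next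
        case False
        with that(1) show ?thesis by (simp add: \<beta>_def product_algebra_def)
      qed
    qed
    show "inj_on \<beta> (carrier A)"
    proof (rule inj_onI)
      fix x y assume xy: "x \<in> carrier A" "y \<in> carrier A" "\<beta> x = \<beta> y"
      have eq: "\<alpha> x i = \<alpha> y i" if "i \<in> I" for i
        using \<beta>[OF that] cls[OF xy(1,2)] xy(3) by metis
      have "\<alpha> x \<in> (\<Pi>\<^sub>E i\<in>I. carrier (B i))" "\<alpha> y \<in> (\<Pi>\<^sub>E i\<in>I. carrier (B i))"
        using emb xy by (auto simp: subdirect_embedding_def homomorphism_def product_algebra_def)
      then have "\<alpha> x = \<alpha> y" using eq by (rule PiE_ext)
      then show "x = y"
        using emb xy by (auto simp: subdirect_embedding_def inj_on_def)
    qed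
    show "(\<lambda>p. p t) ` (\<beta> ` carrier A) = carrier (Q t)" if "t \<in> J" for t
      using that by (simp add: \<beta>_def Q_def quotient_def image_image UNION_singleton_eq_range)
  qed
  then obtain t where "t \<in> J" "isomorphism \<tau> A (Q t) ((\<lambda>p. p t) \<circ> \<beta>)"
    using si unfolding subdirectly_irreducible_def by blast
  then obtain i where i: "i \<in> I" and inj: "inj_on ((\<lambda>p. p (\<theta> i)) \<circ> \<beta>) (carrier A)"
    by (auto simp: J_def isomorphism_def bij_betw_def)
  have "inj_on ((\<lambda>p. p i) \<circ> \<alpha>) (carrier A)"
    using inj by (simp add: inj_on_def \<beta>[OF i] cls)
  moreover have "((\<lambda>p. p i) \<circ> \<alpha>) ` carrier A = carrier (B i)"
    using emb i by (auto simp: subdirect_embedding_def image_comp)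
  moreover have "homomorphism \<tau> A (B i) ((\<lambda>p. p i) \<circ> \<alpha>)"
    unfolding homomorphism_def using coord[OF i] calculation(2) by (auto simp: o_def)
  ultimately show "\<exists>i\<in>I. isomorphism \<tau> A (B i) ((\<lambda>p. p i) \<circ> \<alpha>)"
    using i by (auto simp: isomorphism_def bij_betw_def)
qed

locale bck_algebra =
  fixes X :: "'a set" and star :: "'a \<Rightarrow> 'a \<Rightarrow> 'a" (infixl "\<star>" 70) and zero :: 'a ("\<zero>")
  assumes star_closed: "x \<in> X \<Longrightarrow> y \<in> X \<Longrightarrow> x \<star> y \<in> X"
    and zero_closed: "\<zero> \<in> X"
    and bck1: "x \<in> X \<Longrightarrow> y \<in> X \<Longrightarrow> z \<in> X \<Longrightarrow> ((x \<star> y) \<star> (x \<star> z)) \<star> (z \<star> y) = \<zero>"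
    and bck2: "x \<in> X \<Longrightarrow> x \<star> \<zero> = x"
    and bck3: "x \<in> X \<Longrightarrow> y \<in> X \<Longrightarrow> x \<star> y = \<zero> \<Longrightarrow> y \<star> x = \<zero> \<Longrightarrow> x = y"
    and bck4: "x \<in> X \<Longrightarrow> \<zero> \<star> x = \<zero>"

locale state_bck_algebra = bck_algebra +
  fixes \<mu> :: "'a \<Rightarrow> 'a"
  assumes state_closed: "x \<in> X \<Longrightarrow> \<mu> x \<in> X"
    and S0: "x \<in> X \<Longrightarrow> y \<in> X \<Longrightarrow> x \<star> y = \<zero> \<Longrightarrow> \<mu> x \<star> \<mu> y = \<zero>"
    and S1: "x \<in> X \<Longrightarrow> y \<in> X \<Longrightarrow> \<mu> (x \<star> y) = \<mu> x \<star> \<mu> (x \<star> (x \<star> y))"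
    and S2: "x \<in> X \<Longrightarrow> y \<in> X \<Longrightarrow> \<mu> (\<mu> x \<star> \<mu> y) = \<mu> x \<star> \<mu> y"

definition bck_alg :: "'a set \<Rightarrow> ('a \<Rightarrow> 'a \<Rightarrow> 'a) \<Rightarrow> 'a \<Rightarrow> 'a alg" where
  "bck_alg X star zero =
     \<lparr> carrier = X, ops = [\<lambda>xs. star (xs ! 0) (xs ! 1), \<lambda>_. zero] \<rparr>"

definition state_bck_alg ::
  "'a set \<Rightarrow> ('a \<Rightarrow> 'a \<Rightarrow> 'a) \<Rightarrow> ('a \<Rightarrow> 'a) \<Rightarrow> 'a \<Rightarrow> 'a alg" where
  "state_bck_alg X star \<mu> zero =
     \<lparr> carrier = X, ops = [\<lambda>xs. star (xs ! 0) (xs ! 1), \<lambda>xs. \<mu> (xs ! 0), \<lambda>_. zero] \<rparr>"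

definition bck_ideal :: "'a set \<Rightarrow> ('a \<Rightarrow> 'a \<Rightarrow> 'a) \<Rightarrow> 'a \<Rightarrow> 'a set \<Rightarrow> bool" where
  "bck_ideal X star zero I \<longleftrightarrow>
     I \<subseteq> X \<and> zero \<in> I \<and> (\<forall>x\<in>X. \<forall>y\<in>X. star y x \<in> I \<longrightarrow> x \<in> I \<longrightarrow> y \<in> I)"

definition generated_ideal :: "'a set \<Rightarrow> ('a \<Rightarrow> 'a \<Rightarrow> 'a) \<Rightarrow> 'a \<Rightarrow> 'a \<Rightarrow> 'a set" where
  "generated_ideal X star zero a = \<Inter> {I. bck_ideal X star zero I \<and> a \<in> I}"

definition state_kernel :: "'a set \<Rightarrow> 'a \<Rightarrow> ('a \<Rightarrow> 'a) \<Rightarrow> 'a set" where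
  "state_kernel X zero \<mu> = {x \<in> X. \<mu> x = zero}"

end

theory Submission
  imports Defs
begin

text \<open>
  Everything rests on one fact about BCK-algebras: a congruence is trivial as soon as its zero class
  is \<open>{0}\<close>, because \<open>x \<theta> y\<close> puts \<open>x * y\<close> and \<open>y * x\<close> into the zero class. The zero class
  of a congruence is an ideal, and conversely every ideal \<open>J\<close> is the zero class of the congruence
  ``\<open>x * y \<in> J\<close> and \<open>y * x \<in> J\<close>'', which also respects \<open>\<mu>\<close> if \<open>\<mu> J \<subseteq> J\<close>. Hence
  subdirect irreducibility amounts to the existence of a monolith: a non-zero element \<open>c\<close> that
  lies in every non-zero ideal (in every non-zero \<open>\<mu>\<close>-closed ideal, when \<open>\<mu>\<close> is part of the
  signature). This holds although quotients in the sense of universal algebra need not be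
  BCK-algebras, since the argument only looks at zero classes.

  Let \<open>c\<close> be a monolith element of \<open>(X, \<mu>)\<close>. If \<open>Ker \<mu> = {0}\<close>, then \<open>\<mu> c \<noteq> 0\<close>, and for a
  non-zero ideal \<open>J\<close> of \<open>\<mu> X\<close> the preimage of \<open>J\<close> under \<open>\<mu>\<close> is a non-zero \<open>\<mu>\<close>-closed ideal
  of \<open>X\<close>; so it contains \<open>c\<close>, and \<open>\<mu> c\<close> is a monolith element of \<open>\<mu> X\<close>. If
  \<open>Ker \<mu> \<noteq> {0}\<close>, then \<open>Ker \<mu>\<close> is itself a non-zero \<open>\<mu>\<close>-closed ideal, hence contains \<open>c\<close>; an
  ideal of \<open>Ker \<mu>\<close> is an ideal of \<open>X\<close>, trivially \<open>\<mu>\<close>-closed, so \<open>c\<close> is a monolith element of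
  \<open>Ker \<mu>\<close>. Finally the ideal generated by a fixed point \<open>a\<close> of \<open>\<mu>\<close> is \<open>\<mu>\<close>-closed, so it
  contains \<open>c\<close> as well if \<open>a \<noteq> 0\<close>.
\<close>

section \<open>Subdirect irreducibility and congruences\<close>

definition congruence :: "nat list \<Rightarrow> 'a alg \<Rightarrow> ('a \<times> 'a) set \<Rightarrow> bool" where
  "congruence \<tau> A \<theta> \<longleftrightarrow>
     equiv (carrier A) \<theta> \<and>
     (\<forall>k<length \<tau>. \<forall>xs ys. length xs = \<tau> ! k \<longrightarrow> list_all2 (\<lambda>x y. (x, y) \<in> \<theta>) xs ys \<longrightarrow>
        ((ops A ! k) xs, (ops A ! k) ys) \<in> \<theta>)"

text \<open>The operations act on chosen representatives, which makes the algebra available without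
  a proof that the choice is immaterial; for congruences it is.\<close>

definition quotient_algebra :: "nat list \<Rightarrow> 'a alg \<Rightarrow> ('a \<times> 'a) set \<Rightarrow> 'a set alg" where
  "quotient_algebra \<tau> A \<theta> =
     \<lparr> carrier = carrier A // \<theta>,
       ops = map (\<lambda>k cs. \<theta> `` {(ops A ! k) (map (\<lambda>c. SOME x. x \<in> c) cs)}) [0..<length \<tau>] \<rparr>"

lemma representative_in_class:
  assumes "equiv S \<theta>" and "c \<in> S // \<theta>"
  shows "(SOME x. x \<in> c) \<in> c" and "(SOME x. x \<in> c) \<in> S"
proof -
  show "(SOME x. x \<in> c) \<in> c"
    using assms by (metis in_quotient_imp_non_empty some_in_eq)
  then show "(SOME x. x \<in> c) \<in> S"
    using assms in_quotient_imp_subset by blast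
qed

lemma quotient_is_algebra:
  assumes A: "is_algebra \<tau> A" and \<theta>: "congruence \<tau> A \<theta>"
  shows "is_algebra \<tau> (quotient_algebra \<tau> A \<theta>)"
  unfolding is_algebra_def
proof (intro conjI allI impI)
  have eqv: "equiv (carrier A) \<theta>" using \<theta> by (simp add: congruence_def)
  show "carrier (quotient_algebra \<tau> A \<theta>) \<noteq> {}"
    using A by (auto simp: quotient_algebra_def is_algebra_def quotient_def)
  show "length (ops (quotient_algebra \<tau> A \<theta>)) = length \<tau>"
    by (simp add: quotient_algebra_def)
  fix k cs
  assume k: "k < length \<tau>" "length cs = \<tau> ! k" "set cs \<subseteq> carrier (quotient_algebra \<tau> A \<theta>)"
  have "set (map (\<lambda>c. SOME x. x \<in> c) cs) \<subseteq> carrier A"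
    using k(3) representative_in_class(2)[OF eqv] by (auto simp: quotient_algebra_def)
  then have "(ops A ! k) (map (\<lambda>c. SOME x. x \<in> c) cs) \<in> carrier A"
    using A k(1,2) by (simp add: is_algebra_def)
  then show "(ops (quotient_algebra \<tau> A \<theta>) ! k) cs \<in> carrier (quotient_algebra \<tau> A \<theta>)"
    using k(1) by (simp add: quotient_algebra_def quotientI)
qed

lemma quotient_map_operation:
  assumes \<theta>: "congruence \<tau> A \<theta>"
    and k: "k < length \<tau>" and xs: "length xs = \<tau> ! k" "set xs \<subseteq> carrier A"
  shows "\<theta> `` {(ops A ! k) xs} = (ops (quotient_algebra \<tau> A \<theta>) ! k) (map (\<lambda>x. \<theta> `` {x}) xs)"
proof -
  have eqv: "equiv (carrier A) \<theta>" using \<theta> by (simp add: congruence_def)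
  let ?ys = "map (\<lambda>x. SOME y. y \<in> \<theta> `` {x}) xs"
  have "(x, SOME y. y \<in> \<theta> `` {x}) \<in> \<theta>" if "x \<in> set xs" for x
    using representative_in_class(1)[OF eqv quotientI] that xs(2) by blast
  then have "list_all2 (\<lambda>x y. (x, y) \<in> \<theta>) xs ?ys"
    by (simp add: list_all2_conv_all_nth)
  then have "((ops A ! k) xs, (ops A ! k) ?ys) \<in> \<theta>"
    using \<theta> k xs(1) unfolding congruence_def by blast
  then show ?thesis
    using equiv_class_eq[OF eqv] k by (simp add: quotient_algebra_def o_def)
qed

text \<open>The quotient maps of congruences with trivial intersection form a subdirect embedding, so
  in a subdirectly irreducible algebra one of them is injective.\<close>

lemma subdirectly_irreducible_trivial_congruence:
  fixes A :: "'a alg"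
  assumes A: "is_algebra \<tau> A"
    and si: "subdirectly_irreducible TYPE(('a \<times> 'a) set) TYPE('a set) \<tau> A"
    and cong: "\<And>\<theta>. \<theta> \<in> \<Theta> \<Longrightarrow> congruence \<tau> A \<theta>"
    and meet: "\<And>x y. x \<in> carrier A \<Longrightarrow> y \<in> carrier A \<Longrightarrow> (\<And>\<theta>. \<theta> \<in> \<Theta> \<Longrightarrow> (x, y) \<in> \<theta>) \<Longrightarrow> x = y"
  obtains \<theta> where "\<theta> \<in> \<Theta>" and "\<theta> \<subseteq> Id"
proof -
  define \<alpha> where "\<alpha> x = (\<lambda>\<theta>\<in>\<Theta>. \<theta> `` {x})" for x
  let ?Q = "quotient_algebra \<tau> A"
  have eqv: "equiv (carrier A) \<theta>" if "\<theta> \<in> \<Theta>" for \<theta>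
    using cong[OF that] by (simp add: congruence_def)
  have "subdirect_embedding \<tau> A \<Theta> ?Q \<alpha>"
    unfolding subdirect_embedding_def homomorphism_def
  proof (intro conjI ballI allI impI)
    show "is_algebra \<tau> (?Q \<theta>)" if "\<theta> \<in> \<Theta>" for \<theta>
      using A cong[OF that] by (rule quotient_is_algebra)
    show "\<alpha> ` carrier A \<subseteq> carrier (product_algebra \<tau> \<Theta> ?Q)"
      by (auto simp: \<alpha>_def product_algebra_def quotient_algebra_def intro: quotientI)
    show "\<alpha> ((ops A ! k) xs) = (ops (product_algebra \<tau> \<Theta> ?Q) ! k) (map \<alpha> xs)"
      if "k < length \<tau>" "length xs = \<tau> ! k" "set xs \<subseteq> carrier A" for k xs
      using quotient_map_operation[OF cong that] that(1)
      by (auto simp: \<alpha>_def product_algebra_def o_def fun_eq_iff restrict_def)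
    show "inj_on \<alpha> (carrier A)"
    proof (rule inj_onI)
      fix x y assume xy: "x \<in> carrier A" "y \<in> carrier A" "\<alpha> x = \<alpha> y"
      have "(x, y) \<in> \<theta>" if "\<theta> \<in> \<Theta>" for \<theta>
      proof -
        have "\<theta> `` {x} = \<theta> `` {y}"
          using fun_cong[OF xy(3), of \<theta>] that by (simp add: \<alpha>_def)
        then show ?thesis using eq_equiv_class[OF _ eqv[OF that] xy(2)] by simp
      qed
      then show "x = y" using meet xy by blast
    qed
    show "(\<lambda>p. p \<theta>) ` (\<alpha> ` carrier A) = carrier (?Q \<theta>)" if "\<theta> \<in> \<Theta>" for \<theta>
      using that
      by (simp add: \<alpha>_def quotient_algebra_def quotient_def image_image UNION_singleton_eq_range)
  qed
  then obtain \<theta> where \<theta>: "\<theta> \<in> \<Theta>" and inj: "inj_on ((\<lambda>p. p \<theta>) \<circ> \<alpha>) (carrier A)"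
    using si unfolding subdirectly_irreducible_def isomorphism_def bij_betw_def by blast
  have "\<theta> \<subseteq> Id"
  proof
    fix p assume "p \<in> \<theta>"
    then obtain x y where p: "p = (x, y)" "(x, y) \<in> \<theta>" by (cases p) auto
    then have "x \<in> carrier A" "y \<in> carrier A" "\<theta> `` {x} = \<theta> `` {y}"
      using equiv_class_eq_iff[OF eqv[OF \<theta>]] by blast+
    then have "x = y" using inj \<theta> by (simp add: inj_on_def \<alpha>_def)
    then show "p \<in> Id" using p by simp
  qed
  with \<theta> show thesis by (rule that)
qed

text \<open>The converse criterion: if every non-injective homomorphism identifies the same two distinct
  elements, the coordinates of a subdirect embedding cannot all be non-injective.\<close>

lemma subdirectly_irreducible_by_monolith:
  fixes A :: "'a alg"
  assumes ab: "a \<in> carrier A" "b \<in> carrier A" "a \<noteq> b"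
    and collapse: "\<And>(B :: 'b alg) h.
      homomorphism \<tau> A B h \<Longrightarrow> \<not> inj_on h (carrier A) \<Longrightarrow> h a = h b"
  shows "subdirectly_irreducible TYPE('i) TYPE('b) \<tau> A"
  unfolding subdirectly_irreducible_def
proof (intro allI impI)
  fix I :: "'i set" and B :: "'i \<Rightarrow> 'b alg" and \<alpha>
  assume emb: "subdirect_embedding \<tau> A I B \<alpha>"
  have onto: "((\<lambda>p. p i) \<circ> \<alpha>) ` carrier A = carrier (B i)" if "i \<in> I" for i
    using emb that by (auto simp: subdirect_embedding_def image_comp)
  have hom: "homomorphism \<tau> A (B i) ((\<lambda>p. p i) \<circ> \<alpha>)" if "i \<in> I" for i
    using emb that onto[OF that]
    by (auto simp: subdirect_embedding_def homomorphism_def product_algebra_def o_def)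
  have "\<exists>i\<in>I. inj_on ((\<lambda>p. p i) \<circ> \<alpha>) (carrier A)"
  proof (rule ccontr)
    assume "\<not> ?thesis"
    then have eq: "\<alpha> a i = \<alpha> b i" if "i \<in> I" for i
      using collapse[OF hom[OF that]] that by auto
    have "\<alpha> a \<in> (\<Pi>\<^sub>E i\<in>I. carrier (B i))" "\<alpha> b \<in> (\<Pi>\<^sub>E i\<in>I. carrier (B i))"
      using emb ab(1,2)
      by (auto simp: subdirect_embedding_def homomorphism_def product_algebra_def)
    then have "\<alpha> a = \<alpha> b" using eq by (rule PiE_ext)
    with emb ab show False by (auto simp: subdirect_embedding_def inj_on_def)
  qed
  then show "\<exists>i\<in>I. isomorphism \<tau> A (B i) ((\<lambda>p. p i) \<circ> \<alpha>)"
    using hom onto by (auto simp: isomorphism_def bij_betw_def)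
qed

section \<open>Ideals of BCK-algebras\<close>

context bck_algebra
begin

abbreviation ideal :: "'a set \<Rightarrow> bool" where
  "ideal \<equiv> bck_ideal X (\<star>) \<zero>"

lemma star_self: "x \<in> X \<Longrightarrow> x \<star> x = \<zero>"
  using bck1[of x \<zero> \<zero>] by (simp add: bck2 zero_closed star_closed)

lemma star_le: "x \<in> X \<Longrightarrow> y \<in> X \<Longrightarrow> (x \<star> y) \<star> x = \<zero>"
  using bck1[of x y \<zero>] by (simp add: bck2 bck4 zero_closed star_closed)

lemma star_star_le: "x \<in> X \<Longrightarrow> y \<in> X \<Longrightarrow> (x \<star> (x \<star> y)) \<star> y = \<zero>"
  using bck1[of x \<zero> y] by (simp add: bck2 zero_closed)

lemma star_antimono:
  "x \<in> X \<Longrightarrow> y \<in> X \<Longrightarrow> z \<in> X \<Longrightarrow> z \<star> y = \<zero> \<Longrightarrow> (x \<star> y) \<star> (x \<star> z) = \<zero>"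
  using bck1[of x y z] by (simp add: bck2 star_closed)

lemma le_trans:
  "x \<in> X \<Longrightarrow> y \<in> X \<Longrightarrow> z \<in> X \<Longrightarrow> x \<star> y = \<zero> \<Longrightarrow> y \<star> z = \<zero> \<Longrightarrow> x \<star> z = \<zero>"
  using bck1[of x z y] by (simp add: bck2 star_closed)

text \<open>Interpolate \<open>(x * y) * (x * (x * z))\<close>: since \<open>x * (x * z) \<le> z\<close>, it lies above the left-hand
  side by antitonicity in the second argument, and it lies below the right-hand side by the first
  BCK axiom.\<close>

lemma exchange_le:
  assumes "x \<in> X" "y \<in> X" "z \<in> X"
  shows "((x \<star> y) \<star> z) \<star> ((x \<star> z) \<star> y) = \<zero>"
proof (rule le_trans)
  show "((x \<star> y) \<star> z) \<star> ((x \<star> y) \<star> (x \<star> (x \<star> z))) = \<zero>"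
    using assms by (simp add: star_antimono star_star_le star_closed)
  show "((x \<star> y) \<star> (x \<star> (x \<star> z))) \<star> ((x \<star> z) \<star> y) = \<zero>"
    using assms by (simp add: bck1 star_closed)
qed (use assms in \<open>simp_all add: star_closed\<close>)

lemma exchange: "x \<in> X \<Longrightarrow> y \<in> X \<Longrightarrow> z \<in> X \<Longrightarrow> (x \<star> y) \<star> z = (x \<star> z) \<star> y"
  by (rule bck3) (simp_all add: exchange_le star_closed)

lemma star_mono_difference:
  "x \<in> X \<Longrightarrow> y \<in> X \<Longrightarrow> z \<in> X \<Longrightarrow> ((x \<star> z) \<star> (y \<star> z)) \<star> (x \<star> y) = \<zero>"
  using bck1[of x z y] exchange[of "x \<star> z" "y \<star> z" "x \<star> y"] by (simp add: star_closed)

lemma ideal_cancel: "ideal J \<Longrightarrow> y \<in> X \<Longrightarrow> y \<star> x \<in> J \<Longrightarrow> x \<in> J \<Longrightarrow> y \<in> J"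
  unfolding bck_ideal_def by blast

lemma ideal_down: "ideal J \<Longrightarrow> y \<in> X \<Longrightarrow> x \<in> J \<Longrightarrow> y \<star> x = \<zero> \<Longrightarrow> y \<in> J"
  unfolding bck_ideal_def by auto

definition ideal_congruence :: "'a set \<Rightarrow> ('a \<times> 'a) set" where
  "ideal_congruence J = {(x, y). x \<in> X \<and> y \<in> X \<and> x \<star> y \<in> J \<and> y \<star> x \<in> J}"

lemma equiv_ideal_congruence:
  assumes J: "ideal J"
  shows "equiv X (ideal_congruence J)"
proof (rule equivI)
  have tr: "x \<star> z \<in> J" if "x \<in> X" "y \<in> X" "z \<in> X" "x \<star> y \<in> J" "y \<star> z \<in> J" for x y z
  proof -
    have "(x \<star> z) \<star> (x \<star> y) \<in> J"
      by (rule ideal_down[where x = "y \<star> z", OF J])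
        (use that in \<open>simp_all add: bck1 star_closed\<close>)
    then show ?thesis using J that by (blast intro: ideal_cancel star_closed)
  qed
  show "ideal_congruence J \<subseteq> X \<times> X" by (auto simp: ideal_congruence_def)
  show "refl_on X (ideal_congruence J)"
    using J by (auto simp: refl_on_def ideal_congruence_def star_self bck_ideal_def)
  show "sym (ideal_congruence J)" by (auto simp: sym_def ideal_congruence_def)
  show "trans (ideal_congruence J)"
    by (rule transI) (auto simp: ideal_congruence_def intro: tr)
qed

lemma ideal_congruence_star:
  assumes J: "ideal J"
    and x: "(x, x') \<in> ideal_congruence J" and y: "(y, y') \<in> ideal_congruence J"
  shows "(x \<star> y, x' \<star> y') \<in> ideal_congruence J"
proof -
  have X: "x \<in> X" "x' \<in> X" "y \<in> X" "y' \<in> X" using x y by (auto simp: ideal_congruence_def)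
  have left: "(u \<star> w) \<star> (v \<star> w) \<in> J" if "u \<in> X" "v \<in> X" "w \<in> X" "u \<star> v \<in> J" for u v w
    by (rule ideal_down[where x = "u \<star> v", OF J])
      (use that in \<open>simp_all add: star_mono_difference star_closed\<close>)
  have right: "(w \<star> u) \<star> (w \<star> v) \<in> J" if "u \<in> X" "v \<in> X" "w \<in> X" "v \<star> u \<in> J" for u v w
    by (rule ideal_down[where x = "v \<star> u", OF J])
      (use that in \<open>simp_all add: bck1 star_closed\<close>)
  have "(x \<star> y, x' \<star> y) \<in> ideal_congruence J"
    using x X left by (auto simp: ideal_congruence_def star_closed)
  moreover have "(x' \<star> y, x' \<star> y') \<in> ideal_congruence J"
    using y X right by (auto simp: ideal_congruence_def star_closed)
  ultimately show ?thesis
    using equiv_ideal_congruence[OF J] by (meson equivE transD)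
qed

lemma is_algebra_bck: "is_algebra [2, 0] (bck_alg X (\<star>) \<zero>)"
  using zero_closed star_closed
  by (auto simp: is_algebra_def bck_alg_def less_Suc_eq numeral_2_eq_2 length_Suc_conv)

text \<open>The zero class of a non-injective homomorphism is a non-zero ideal, whatever algebra of the
  right type the homomorphism maps to.\<close>

lemma subdirectly_irreducible_bckI:
  assumes c: "c \<in> X" "c \<noteq> \<zero>"
    and monolith: "\<And>J. ideal J \<Longrightarrow> J \<noteq> {\<zero>} \<Longrightarrow> c \<in> J"
  shows "subdirectly_irreducible TYPE('i) TYPE('b) [2, 0] (bck_alg X (\<star>) \<zero>)"
proof (rule subdirectly_irreducible_by_monolith)
  show "c \<in> carrier (bck_alg X (\<star>) \<zero>)" "\<zero> \<in> carrier (bck_alg X (\<star>) \<zero>)" "c \<noteq> \<zero>"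
    using c zero_closed by (auto simp: bck_alg_def)
  fix B :: "'b alg" and h
  assume hom: "homomorphism [2, 0] (bck_alg X (\<star>) \<zero>) B h"
    and "\<not> inj_on h (carrier (bck_alg X (\<star>) \<zero>))"
  then obtain u v where uv: "u \<in> X" "v \<in> X" "h u = h v" "u \<noteq> v"
    by (auto simp: inj_on_def bck_alg_def)
  have star: "h (x \<star> y) = (ops B ! 0) [h x, h y]" if "x \<in> X" "y \<in> X" for x y
    using hom[unfolded homomorphism_def, THEN conjunct2, rule_format, of 0 "[x, y]"] that
    by (simp add: bck_alg_def)
  define J where "J = {x \<in> X. h x = h \<zero>}"
  have "ideal J"
    unfolding bck_ideal_def
  proof (intro conjI ballI impI)
    show "J \<subseteq> X" "\<zero> \<in> J" using zero_closed by (auto simp: J_def)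
    fix x y assume *: "x \<in> X" "y \<in> X" "y \<star> x \<in> J" "x \<in> J"
    have "h y = h (y \<star> \<zero>)" using * by (simp add: bck2)
    also have "\<dots> = h (y \<star> x)" using * star zero_closed by (simp add: J_def)
    finally show "y \<in> J" using * by (simp add: J_def)
  qed
  moreover have "J \<noteq> {\<zero>}"
  proof
    assume J0: "J = {\<zero>}"
    have "h (u \<star> v) = h (v \<star> v)" "h (v \<star> u) = h (v \<star> v)" using star uv by simp_all
    then have "u \<star> v \<in> J" "v \<star> u \<in> J" using uv by (simp_all add: J_def star_self star_closed)
    with J0 uv bck3 show False by blast
  qed
  ultimately have "c \<in> J" by (rule monolith)
  then show "h c = h \<zero>" by (simp add: J_def)
qed

lemma bck_algebra_subset:
  assumes "S \<subseteq> X" "\<zero> \<in> S" "\<And>x y. x \<in> S \<Longrightarrow> y \<in> S \<Longrightarrow> x \<star> y \<in> S"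
  shows "bck_algebra S (\<star>) \<zero>"
proof
  fix x y z assume "x \<in> S" "y \<in> S" "z \<in> S"
  then show "((x \<star> y) \<star> (x \<star> z)) \<star> (z \<star> y) = \<zero>"
    using assms(1) bck1 by blast
qed (use assms bck2 bck3 bck4 in blast)+

lemma subalgebra_bck:
  assumes "S \<subseteq> X" "bck_algebra S (\<star>) \<zero>"
  shows "subalgebra [2, 0] (bck_alg S (\<star>) \<zero>) (bck_alg X (\<star>) \<zero>)"
  using assms(1) is_algebra_bck bck_algebra.is_algebra_bck[OF assms(2)]
  by (auto simp: subalgebra_def bck_alg_def)

lemma generated_ideal_is_ideal:
  assumes "a \<in> X"
  shows "ideal (generated_ideal X (\<star>) \<zero> a)"
proof -
  have "ideal X" using zero_closed by (auto simp: bck_ideal_def)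
  then have "generated_ideal X (\<star>) \<zero> a \<subseteq> X"
    using assms by (auto simp: generated_ideal_def)
  then show ?thesis
    unfolding bck_ideal_def[of _ _ _ "generated_ideal X (\<star>) \<zero> a"]
    by (auto simp: generated_ideal_def bck_ideal_def)
qed

lemma mem_generated_ideal: "a \<in> generated_ideal X (\<star>) \<zero> a"
  by (auto simp: generated_ideal_def)

lemma generated_ideal_least: "ideal J \<Longrightarrow> a \<in> J \<Longrightarrow> generated_ideal X (\<star>) \<zero> a \<subseteq> J"
  by (auto simp: generated_ideal_def)

end

section \<open>State operators and their closed ideals\<close>

context state_bck_algebra
begin

abbreviation kernel :: "'a set" where
  "kernel \<equiv> state_kernel X \<zero> \<mu>"

lemma state_zero: "\<mu> \<zero> = \<zero>"
  using S1[of \<zero> \<zero>] by (simp add: star_self zero_closed state_closed)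

lemma state_idem: "x \<in> X \<Longrightarrow> \<mu> (\<mu> x) = \<mu> x"
  using S2[of x \<zero>] by (simp add: state_zero zero_closed bck2 state_closed)

text \<open>Only half of a homomorphism property survives for \<open>\<mu>\<close>; it follows from (S1) because
  \<open>x * (x * y) \<le> y\<close>, and it suffices for all arguments about ideals.\<close>

lemma state_star_le:
  assumes "x \<in> X" "y \<in> X"
  shows "(\<mu> x \<star> \<mu> y) \<star> \<mu> (x \<star> y) = \<zero>"
proof -
  have "\<mu> (x \<star> (x \<star> y)) \<star> \<mu> y = \<zero>"
    using assms by (simp add: S0 star_star_le star_closed)
  then show ?thesis
    using assms by (subst S1) (simp_all add: star_antimono state_closed star_closed)
qed

definition state_ideal :: "'a set \<Rightarrow> bool" where
  "state_ideal J \<longleftrightarrow> ideal J \<and> \<mu> ` J \<subseteq> J"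

lemma ideal_congruence_state:
  assumes J: "state_ideal J" and xy: "(x, y) \<in> ideal_congruence J"
  shows "(\<mu> x, \<mu> y) \<in> ideal_congruence J"
proof -
  have "\<mu> u \<star> \<mu> v \<in> J" if "u \<in> X" "v \<in> X" "u \<star> v \<in> J" for u v
  proof (rule ideal_down[where x = "\<mu> (u \<star> v)"])
    show "ideal J" "\<mu> (u \<star> v) \<in> J" using J that by (auto simp: state_ideal_def)
  qed (use that in \<open>simp_all add: state_star_le state_closed star_closed\<close>)
  with xy show ?thesis by (auto simp: ideal_congruence_def state_closed)
qed

lemma is_algebra_state_bck: "is_algebra [2, 1, 0] (state_bck_alg X (\<star>) \<mu> \<zero>)"
  using zero_closed star_closed state_closed
  by (auto simp: is_algebra_def state_bck_alg_def less_Suc_eq numeral_2_eq_2 length_Suc_conv)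

lemma congruence_state_ideal:
  assumes J: "state_ideal J"
  shows "congruence [2, 1, 0] (state_bck_alg X (\<star>) \<mu> \<zero>) (ideal_congruence J)"
proof -
  have "ideal J" using J by (simp add: state_ideal_def)
  moreover from this have "(\<zero>, \<zero>) \<in> ideal_congruence J"
    using zero_closed by (simp add: ideal_congruence_def star_self bck_ideal_def)
  ultimately show ?thesis
    using ideal_congruence_state[OF J]
    by (auto simp: congruence_def state_bck_alg_def equiv_ideal_congruence less_Suc_eq
        numeral_2_eq_2 length_Suc_conv list_all2_Cons1 ideal_congruence_star)
qed

text \<open>Without a common non-zero element of the non-zero \<open>\<mu>\<close>-closed ideals, the congruences of
  these ideals would intersect trivially although none of them is trivial.\<close>

lemma monolith_exists:
  assumes "subdirectly_irreducible TYPE(('a \<times> 'a) set) TYPE('a set) [2, 1, 0]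
    (state_bck_alg X (\<star>) \<mu> \<zero>)"
  obtains c where "c \<in> X" "c \<noteq> \<zero>" "\<And>J. state_ideal J \<Longrightarrow> J \<noteq> {\<zero>} \<Longrightarrow> c \<in> J"
proof (rule ccontr)
  note witness = that
  assume "\<not> thesis"
  then have sep: "x = \<zero>" if "x \<in> X" "\<And>J. state_ideal J \<Longrightarrow> J \<noteq> {\<zero>} \<Longrightarrow> x \<in> J" for x
    using witness[of x] that by blast
  let ?\<Theta> = "ideal_congruence ` {J. state_ideal J \<and> J \<noteq> {\<zero>}}"
  obtain \<theta> where "\<theta> \<in> ?\<Theta>" "\<theta> \<subseteq> Id"
  proof (rule subdirectly_irreducible_trivial_congruence[OF is_algebra_state_bck assms])
    show "congruence [2, 1, 0] (state_bck_alg X (\<star>) \<mu> \<zero>) \<theta>" if "\<theta> \<in> ?\<Theta>" for \<theta>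
      using that congruence_state_ideal by auto
    fix x y
    assume "x \<in> carrier (state_bck_alg X (\<star>) \<mu> \<zero>)" "y \<in> carrier (state_bck_alg X (\<star>) \<mu> \<zero>)"
    then have X: "x \<in> X" "y \<in> X" by (simp_all add: state_bck_alg_def)
    assume "(x, y) \<in> \<theta>" if "\<theta> \<in> ?\<Theta>" for \<theta>
    then have "x \<star> y \<in> J" "y \<star> x \<in> J" if "state_ideal J" "J \<noteq> {\<zero>}" for J
      using that by (auto simp: ideal_congruence_def)
    then have "x \<star> y = \<zero>" "y \<star> x = \<zero>" using X by (simp_all add: sep star_closed)
    with X show "x = y" by (rule bck3)
  qed
  then obtain J where J: "state_ideal J" "J \<noteq> {\<zero>}" "ideal_congruence J \<subseteq> Id" by auto
  then obtain j where "j \<in> J" "j \<noteq> \<zero>" by (auto simp: state_ideal_def bck_ideal_def)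
  moreover from this J(1) have "(j, \<zero>) \<in> ideal_congruence J"
    by (auto simp: ideal_congruence_def state_ideal_def bck_ideal_def bck2 bck4)
  ultimately show False using J(3) by auto
qed

lemma bck_algebra_image: "bck_algebra (\<mu> ` X) (\<star>) \<zero>"
proof (rule bck_algebra_subset)
  show "\<mu> ` X \<subseteq> X" by (auto simp: state_closed)
  show "\<zero> \<in> \<mu> ` X" using state_zero zero_closed by (metis image_eqI)
  show "x \<star> y \<in> \<mu> ` X" if xy: "x \<in> \<mu> ` X" "y \<in> \<mu> ` X" for x y
  proof -
    obtain u v where "u \<in> X" "v \<in> X" "x = \<mu> u" "y = \<mu> v" using xy by blast
    then show ?thesis using S2[of u v] by (metis image_eqI star_closed state_closed)
  qed
qed

lemma state_ideal_kernel: "state_ideal kernel"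
  unfolding state_ideal_def bck_ideal_def
proof (intro conjI ballI impI)
  show "kernel \<subseteq> X" "\<zero> \<in> kernel" by (auto simp: state_kernel_def state_zero zero_closed)
  show "\<mu> ` kernel \<subseteq> kernel"
    by (rule image_subsetI) (simp add: state_kernel_def state_zero zero_closed)
  fix x y assume "x \<in> X" "y \<in> X" "y \<star> x \<in> kernel" "x \<in> kernel"
  then show "y \<in> kernel"
    using state_star_le[of y x] by (simp add: state_kernel_def bck2 state_closed star_closed)
qed

lemma bck_algebra_kernel: "bck_algebra kernel (\<star>) \<zero>"
proof (rule bck_algebra_subset)
  show "kernel \<subseteq> X" "\<zero> \<in> kernel" by (auto simp: state_kernel_def state_zero zero_closed)
  show "x \<star> y \<in> kernel" if "x \<in> kernel" "y \<in> kernel" for x y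
    using that S0[of "x \<star> y" x]
    by (simp add: state_kernel_def star_le star_closed bck2 state_closed)
qed

lemma state_ideal_vimage:
  assumes J: "bck_ideal (\<mu> ` X) (\<star>) \<zero> J"
  shows "state_ideal {x \<in> X. \<mu> x \<in> J}"
  unfolding state_ideal_def bck_ideal_def
proof (intro conjI ballI impI)
  interpret image: bck_algebra "\<mu> ` X" "(\<star>)" \<zero> by (rule bck_algebra_image)
  show "{x \<in> X. \<mu> x \<in> J} \<subseteq> X" by auto
  show "\<zero> \<in> {x \<in> X. \<mu> x \<in> J}" using J by (auto simp: state_zero zero_closed bck_ideal_def)
  show "\<mu> ` {x \<in> X. \<mu> x \<in> J} \<subseteq> {x \<in> X. \<mu> x \<in> J}" by (auto simp: state_closed state_idem)
  fix x y assume *: "x \<in> X" "y \<in> X" "y \<star> x \<in> {x \<in> X. \<mu> x \<in> J}" "x \<in> {x \<in> X. \<mu> x \<in> J}"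
  then have "\<mu> y \<star> \<mu> x \<in> J"
    using image.ideal_down[OF J] state_star_le[of y x] image.star_closed by blast
  then show "y \<in> {x \<in> X. \<mu> x \<in> J}" using * image.ideal_cancel[OF J] by blast
qed

lemma state_ideal_of_kernel_ideal:
  assumes J: "bck_ideal kernel (\<star>) \<zero> J"
  shows "state_ideal J"
proof -
  have "y \<in> J" if "x \<in> X" "y \<in> X" "y \<star> x \<in> J" "x \<in> J" for x y
  proof -
    have "J \<subseteq> kernel" using J by (simp add: bck_ideal_def)
    then have "y \<in> kernel"
      using that state_ideal_kernel ideal_cancel[of kernel y x] by (auto simp: state_ideal_def)
    with that J show ?thesis by (auto simp: bck_ideal_def)
  qed
  then show ?thesis using J by (auto simp: state_ideal_def bck_ideal_def state_kernel_def)
qed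

text \<open>The elements whose image under \<open>\<mu>\<close> lies in \<open>\<langle>a\<rangle>\<close> form an ideal; it contains \<open>a\<close>,
  hence \<open>\<langle>a\<rangle>\<close>.\<close>

lemma state_ideal_generated:
  assumes a: "a \<in> X" "\<mu> a = a"
  shows "state_ideal (generated_ideal X (\<star>) \<zero> a)"
proof -
  let ?G = "generated_ideal X (\<star>) \<zero> a"
  have G: "ideal ?G" using a(1) by (rule generated_ideal_is_ideal)
  have "ideal {x \<in> X. \<mu> x \<in> ?G}"
    unfolding bck_ideal_def
  proof (intro conjI ballI impI)
    show "{x \<in> X. \<mu> x \<in> ?G} \<subseteq> X" by auto
    show "\<zero> \<in> {x \<in> X. \<mu> x \<in> ?G}"
      using G by (simp add: state_zero zero_closed bck_ideal_def)
    fix x y assume *: "x \<in> X" "y \<in> X" "y \<star> x \<in> {x \<in> X. \<mu> x \<in> ?G}" "x \<in> {x \<in> X. \<mu> x \<in> ?G}"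
    then have "\<mu> y \<star> \<mu> x \<in> ?G"
      using ideal_down[OF G] state_star_le[of y x] by (blast intro: star_closed state_closed)
    then show "y \<in> {x \<in> X. \<mu> x \<in> ?G}" using * ideal_cancel[OF G] state_closed by blast
  qed
  then have "?G \<subseteq> {x \<in> X. \<mu> x \<in> ?G}"
    using a mem_generated_ideal by (intro generated_ideal_least) simp_all
  with G show ?thesis by (auto simp: state_ideal_def)
qed

lemma subdirectly_irreducible_image:
  assumes ker: "kernel = {\<zero>}" and c: "c \<in> X" "c \<noteq> \<zero>"
    and monolith: "\<And>J. state_ideal J \<Longrightarrow> J \<noteq> {\<zero>} \<Longrightarrow> c \<in> J"
  shows "subdirectly_irreducible TYPE('i) TYPE('b) [2, 0] (bck_alg (\<mu> ` X) (\<star>) \<zero>)"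
proof (rule bck_algebra.subdirectly_irreducible_bckI[OF bck_algebra_image])
  show "\<mu> c \<in> \<mu> ` X" using c by simp
  show "\<mu> c \<noteq> \<zero>" using ker c by (auto simp: state_kernel_def)
  fix J assume J: "bck_ideal (\<mu> ` X) (\<star>) \<zero> J" "J \<noteq> {\<zero>}"
  \<comment> \<open>The elements of \<open>J\<close> are fixed points of \<open>\<mu>\<close>, so \<open>J\<close> is contained in its preimage.\<close>
  have "J \<subseteq> {x \<in> X. \<mu> x \<in> J}"
    using J(1) by (auto simp: bck_ideal_def state_closed state_idem)
  then have "{x \<in> X. \<mu> x \<in> J} \<noteq> {\<zero>}" using J by (auto simp: bck_ideal_def)
  then show "\<mu> c \<in> J" using monolith[OF state_ideal_vimage[OF J(1)]] by simp
qed

lemma subdirectly_irreducible_kernel: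
  assumes ker: "kernel \<noteq> {\<zero>}" and c: "c \<noteq> \<zero>"
    and monolith: "\<And>J. state_ideal J \<Longrightarrow> J \<noteq> {\<zero>} \<Longrightarrow> c \<in> J"
  shows "subdirectly_irreducible TYPE('i) TYPE('b) [2, 0] (bck_alg kernel (\<star>) \<zero>)"
  using monolith[OF state_ideal_kernel ker] c monolith[OF state_ideal_of_kernel_ideal]
  by (rule bck_algebra.subdirectly_irreducible_bckI[OF bck_algebra_kernel])

lemma kernel_meets_generated_ideal:
  assumes ker: "kernel \<noteq> {\<zero>}" and c: "c \<noteq> \<zero>"
    and monolith: "\<And>J. state_ideal J \<Longrightarrow> J \<noteq> {\<zero>} \<Longrightarrow> c \<in> J"
    and a: "a \<in> \<mu> ` X" "a \<noteq> \<zero>"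
  shows "kernel \<inter> generated_ideal X (\<star>) \<zero> a \<noteq> {\<zero>}"
proof -
  have "a \<in> X" "\<mu> a = a" using a(1) by (auto simp: state_closed state_idem)
  then have "c \<in> generated_ideal X (\<star>) \<zero> a"
    using monolith[OF state_ideal_generated] mem_generated_ideal[of a] a(2) by blast
  then show ?thesis using monolith[OF state_ideal_kernel ker] c by blast
qed

end

section \<open>Image and kernel of a subdirectly irreducible state BCK-algebra\<close>

theorem theorem3p14:
  fixes X :: "'a set" and star :: "'a \<Rightarrow> 'a \<Rightarrow> 'a" and zero :: 'a and \<mu> :: "'a \<Rightarrow> 'a"
  assumes "state_bck_algebra X star zero \<mu>"
    and "subdirectly_irreducible TYPE(('a \<times> 'a) set) TYPE('a set) [2, 1, 0]
           (state_bck_alg X star \<mu> zero)"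
  shows "(state_kernel X zero \<mu> = {zero} \<longrightarrow>
            subalgebra [2, 0] (bck_alg (\<mu> ` X) star zero) (bck_alg X star zero) \<and>
            subdirectly_irreducible TYPE('i) TYPE('b) [2, 0] (bck_alg (\<mu> ` X) star zero)) \<and>
         (state_kernel X zero \<mu> \<noteq> {zero} \<longrightarrow>
            subalgebra [2, 0] (bck_alg (state_kernel X zero \<mu>) star zero) (bck_alg X star zero) \<and>
            subdirectly_irreducible TYPE('i) TYPE('b) [2, 0]
              (bck_alg (state_kernel X zero \<mu>) star zero) \<and>
            (\<forall>a \<in> \<mu> ` X. a \<noteq> zero \<longrightarrow>
               state_kernel X zero \<mu> \<inter> generated_ideal X star zero a \<noteq> {zero}))"
proof -
  interpret state_bck_algebra X star zero \<mu> by (rule assms(1))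
  obtain c where c: "c \<in> X" "c \<noteq> zero"
    and monolith: "\<And>J. state_ideal J \<Longrightarrow> J \<noteq> {zero} \<Longrightarrow> c \<in> J"
    using monolith_exists[OF assms(2)] by blast
  have "\<mu> ` X \<subseteq> X" "kernel \<subseteq> X" by (auto simp: state_closed state_kernel_def)
  then have "subalgebra [2, 0] (bck_alg (\<mu> ` X) star zero) (bck_alg X star zero)"
    and "subalgebra [2, 0] (bck_alg kernel star zero) (bck_alg X star zero)"
    using subalgebra_bck bck_algebra_image bck_algebra_kernel by blast+
  then show ?thesis
    using subdirectly_irreducible_image[OF _ c monolith]
      subdirectly_irreducible_kernel[OF _ c(2) monolith]
      kernel_meets_generated_ideal[OF _ c(2) monolith]
    by blast
qed

end
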